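(* Let $B=[a_{ik}]_{n\times n}$ be a square matrix of size $n$, let $j\in\{1,\dots,n\}$ and let $m$ be a positive integer. Let $A$ be the matrix obtained by duplicating the $j$th row of $B$ $m$ times and then duplicating the $j$th column of the new matrix $m$ times. Let $v_j=[x_1,\dots,x_n]^t$ and $w_j=[x_1,\dots,\underbrace{x_j,x_j,\dots,x_j}_{m\text{ times}},\dots,x_n]^t$. If $Bv_j=\lambda_jv_j$ and $Aw_j=\mu_jw_j$ and $\sum_{i=1}^{n}x_i\neq 0$, then $$\mu_j=\lambda_j+\frac{\sum_{i=1}^{n}a_{ij}}{\sum_{i=1}^{n}x_i}\,(m-1)\,x_j.$$
   Context: Duplicating a row (or column) $m$ times means replacing it by $m$ consecutive copies of itself, so that $m$ copies occur in total and $A$ has size $n+m-1$. Matrices and vectors have real or complex entries. *)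

theory Defs
  imports Complex_Main "Jordan_Normal_Form.Matrix"
begin

text \<open>
  Rows, columns and entries are numbered from 0, as everywhere in \<^theory>\<open>Jordan_Normal_Form.Matrix\<close>;
  position \<open>j\<close> below is meaningful for \<open>j < length xs\<close>. After duplication there are
  \<open>m\<close> copies in total, not \<open>m\<close> additional ones.
\<close>

definition duplicate_nth :: "nat \<Rightarrow> nat \<Rightarrow> 'a list \<Rightarrow> 'a list" where
  "duplicate_nth j m xs = take j xs @ replicate m (xs ! j) @ drop (Suc j) xs"

definition duplicate_row :: "nat \<Rightarrow> nat \<Rightarrow> 'a mat \<Rightarrow> 'a mat" where
  "duplicate_row j m B = mat_of_rows (dim_col B) (duplicate_nth j m (rows B))"

definition duplicate_col :: "nat \<Rightarrow> nat \<Rightarrow> 'a mat \<Rightarrow> 'a mat" where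
  "duplicate_col j m B = mat_of_cols (dim_row B) (duplicate_nth j m (cols B))"

definition duplicate_entry :: "nat \<Rightarrow> nat \<Rightarrow> 'a vec \<Rightarrow> 'a vec" where
  "duplicate_entry j m v = vec_of_list (duplicate_nth j m (list_of_vec v))"

lemma length_duplicate_nth:
  "j < length xs \<Longrightarrow> 0 < m \<Longrightarrow> length (duplicate_nth j m xs) = length xs + m - 1"
  by (simp add: duplicate_nth_def)

lemma duplicate_row_carrier:
  assumes "B \<in> carrier_mat n k" "j < n" "0 < m"
  shows "duplicate_row j m B \<in> carrier_mat (n + m - 1) k"
  unfolding duplicate_row_def carrier_mat_def
  using assms by (simp add: length_duplicate_nth)

lemma duplicate_col_carrier:
  assumes "B \<in> carrier_mat n k" "j < k" "0 < m"
  shows "duplicate_col j m B \<in> carrier_mat n (k + m - 1)"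
  unfolding duplicate_col_def carrier_mat_def
  using assms by (simp add: length_duplicate_nth)

lemma duplicate_entry_carrier:
  assumes "v \<in> carrier_vec n" "j < n" "0 < m"
  shows "duplicate_entry j m v \<in> carrier_vec (n + m - 1)"
proof -
  have "length (list_of_vec v) = n" using assms(1) by simp
  then show ?thesis using length_duplicate_nth[of j "list_of_vec v" m] assms(2,3)
    by (intro carrier_vecI) (simp only: duplicate_entry_def dim_vec_of_list)
qed

end

theory Submission
  imports Defs
begin

text \<open>
  Rows of \<open>A\<close> are duplicates of rows of \<open>B\<close>, and pairing row \<open>i\<close> with \<open>w\<close> counts the
  \<open>j\<close>th term \<open>m\<close> times instead of once. So \<open>A w = \<mu> w\<close> says that
  \<open>\<lambda> x\<^sub>i + (m - 1) a\<^sub>i\<^sub>j x\<^sub>j = \<mu> x\<^sub>i\<close> for every \<open>i\<close>; summing over \<open>i\<close> gives the claim.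
\<close>

lemma duplicate_nth_map:
  "j < length xs \<Longrightarrow> duplicate_nth j m (map f xs) = map f (duplicate_nth j m xs)"
  by (simp add: duplicate_nth_def take_map drop_map)

text \<open>With \<open>0 < m\<close> a copy of \<open>xs ! j\<close> survives. For index lists this
  keeps source indices in range and gives every old index a new position.\<close>

lemma set_duplicate_nth:
  assumes "j < length xs" "0 < m"
  shows "set (duplicate_nth j m xs) = set xs"
proof -
  have "set xs = set (take j xs @ xs ! j # drop (Suc j) xs)"
    using id_take_nth_drop[OF assms(1)] by simp
  then show ?thesis
    using assms(2) by (simp add: duplicate_nth_def)
qed

lemma sum_list_duplicate_nth:
  fixes xs :: "'a :: comm_ring_1 list"
  assumes "j < length xs"
  shows "sum_list (duplicate_nth j m xs) = sum_list xs + (of_nat m - 1) * xs ! j"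
proof -
  have "sum_list xs = sum_list (take j xs @ xs ! j # drop (Suc j) xs)"
    using id_take_nth_drop[OF assms] by simp
  then show ?thesis
    by (simp add: duplicate_nth_def sum_list_replicate algebra_simps)
qed

text \<open>Since \<open>xs\<close> is the image of its index list under \<open>(!) xs\<close> and
  duplication commutes with \<open>map\<close>, one source map
  \<open>duplicate_nth j m [0..<n]\<close>, from new positions to old, describes rows, columns and
  vector entries alike.\<close>

lemma nth_duplicate_nth:
  assumes "j < length xs" "p < length (duplicate_nth j m xs)"
  shows "duplicate_nth j m xs ! p = xs ! (duplicate_nth j m [0..<length xs] ! p)"
proof -
  have "duplicate_nth j m xs = map ((!) xs) (duplicate_nth j m [0..<length xs])"
    using duplicate_nth_map[of j "[0..<length xs]" m "(!) xs"] assms(1) by (simp add: map_nth)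
  then show ?thesis
    using assms(2) by (metis length_map nth_map)
qed

lemma duplicate_nth_upt_less:
  assumes "j < n" "0 < m" "p < n + m - 1"
  shows "duplicate_nth j m [0..<n] ! p < n"
proof -
  have "duplicate_nth j m [0..<n] ! p \<in> set (duplicate_nth j m [0..<n])"
    using assms by (intro nth_mem) (simp add: length_duplicate_nth)
  then show ?thesis
    using assms set_duplicate_nth[of j "[0..<n]" m] by simp
qed

lemma index_duplicate_row:
  assumes "B \<in> carrier_mat n k" "j < n" "0 < m" "p < n + m - 1" "q < k"
  shows "duplicate_row j m B $$ (p, q) = B $$ (duplicate_nth j m [0..<n] ! p, q)"
  using assms duplicate_nth_upt_less[of j n m p] nth_duplicate_nth[of j "rows B" p m]
  by (simp add: duplicate_row_def length_duplicate_nth mat_of_rows_index)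

lemma index_duplicate_col:
  assumes "B \<in> carrier_mat n k" "j < k" "0 < m" "p < n" "q < k + m - 1"
  shows "duplicate_col j m B $$ (p, q) = B $$ (p, duplicate_nth j m [0..<k] ! q)"
  using assms duplicate_nth_upt_less[of j k m q] nth_duplicate_nth[of j "cols B" q m]
  by (simp add: duplicate_col_def length_duplicate_nth mat_of_cols_index)

lemma index_duplicate_entry:
  assumes "v \<in> carrier_vec n" "j < n" "0 < m" "p < n + m - 1"
  shows "duplicate_entry j m v $ p = v $ (duplicate_nth j m [0..<n] ! p)"
proof -
  have "length (list_of_vec v) = n"
    using assms(1) by simp
  then show ?thesis
    using assms nth_duplicate_nth[of j "list_of_vec v" p m]
    by (simp only: duplicate_entry_def vec_of_list_index list_of_vec_index length_duplicate_nth)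
qed

text \<open>Reading the summands along the source map turns this into the sum of a duplicated list,
  where \<open>m\<close> copies of \<open>f j\<close> replace one.\<close>

lemma sum_duplicate_nth:
  fixes f :: "nat \<Rightarrow> 'a :: comm_ring_1"
  assumes "j < n" "0 < m"
  shows "(\<Sum>p<n + m - 1. f (duplicate_nth j m [0..<n] ! p))
    = (\<Sum>i<n. f i) + (of_nat m - 1) * f j"
proof -
  let ?src = "duplicate_nth j m [0..<n]"
  have "(\<Sum>p<n + m - 1. f (?src ! p)) = sum_list (map f ?src)"
    using assms by (simp add: sum_list_sum_nth length_duplicate_nth atLeast0LessThan)
  also have "\<dots> = sum_list (duplicate_nth j m (map f [0..<n]))"
    using assms by (simp add: duplicate_nth_map)
  also have "\<dots> = sum_list (map f [0..<n]) + (of_nat m - 1) * f j"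
    using assms by (simp add: sum_list_duplicate_nth)
  also have "sum_list (map f [0..<n]) = (\<Sum>i<n. f i)"
    by (simp add: interv_sum_list_conv_sum_set_nat atLeast0LessThan)
  finally show ?thesis .
qed

theorem proposition5p1:
  fixes A B :: "'a :: real_normed_field mat"
    and v w :: "'a vec"
    and lam mu :: 'a
    and n j m :: nat
  assumes "B \<in> carrier_mat n n"
    and "j < n"
    and "0 < m"
    and "A = duplicate_col j m (duplicate_row j m B)"
    and "v \<in> carrier_vec n"
    and "w = duplicate_entry j m v"
    and "B *\<^sub>v v = lam \<cdot>\<^sub>v v"
    and "A *\<^sub>v w = mu \<cdot>\<^sub>v w"
    and "(\<Sum>i<n. v $ i) \<noteq> 0"
  shows "mu = lam + (\<Sum>i<n. B $$ (i, j)) / (\<Sum>i<n. v $ i) * (of_nat m - 1) * v $ j"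
proof -
  let ?N = "n + m - 1"
  let ?src = "duplicate_nth j m [0..<n]"
  have R: "duplicate_row j m B \<in> carrier_mat ?N n"
    using assms by (intro duplicate_row_carrier)
  then have A: "A \<in> carrier_mat ?N ?N"
    using assms by (simp only: duplicate_col_carrier)
  have w: "w \<in> carrier_vec ?N"
    using assms by (simp only: duplicate_entry_carrier)
  \<comment> \<open>Rows and columns share the same source map. The row lemma is applied at column
    \<open>?src ! q\<close>, which must therefore lie below \<open>n\<close>.\<close>
  have A_index: "A $$ (p, q) = B $$ (?src ! p, ?src ! q)" if "p < ?N" "q < ?N" for p q
    using index_duplicate_col[OF R assms(2,3) that]
      index_duplicate_row[OF assms(1-3) that(1) duplicate_nth_upt_less[OF assms(2,3) that(2)]]
    by (simp only: assms(4))
  have w_index: "w $ p = v $ (?src ! p)" if "p < ?N" for p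
    using index_duplicate_entry[OF assms(5,2,3) that] by (simp only: assms(6))
  have row_eq: "mu * v $ i = lam * v $ i + (of_nat m - 1) * (B $$ (i, j) * v $ j)"
    if i: "i < n" for i
  proof -
    \<comment> \<open>Some row \<open>p\<close> of \<open>A\<close> is a copy of row
      \<open>i\<close> of \<open>B\<close>; component \<open>p\<close> of the eigenvector equation
      for \<open>A\<close> is the one to read off.\<close>
    have "i \<in> set ?src"
      using i assms(2,3) by (simp add: set_duplicate_nth)
    then obtain p where p: "p < ?N" "?src ! p = i"
      using assms(2,3) by (auto simp: in_set_conv_nth length_duplicate_nth)
    have "mu * v $ i = (A *\<^sub>v w) $ p"
      using p w w_index[OF p(1)] assms(8) by simp
    also have "\<dots> = (\<Sum>q<?N. A $$ (p, q) * w $ q)"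
      using p(1) A w by (simp add: scalar_prod_def atLeast0LessThan)
    also have "\<dots> = (\<Sum>q<?N. B $$ (i, ?src ! q) * v $ (?src ! q))"
      using p by (intro sum.cong) (simp_all add: A_index w_index)
    \<comment> \<open>Here \<open>f k\<close> is \<open>B $$ (i, k) * v $ k\<close>.\<close>
    also have "\<dots> = (\<Sum>k<n. B $$ (i, k) * v $ k) + (of_nat m - 1) * (B $$ (i, j) * v $ j)"
      by (rule sum_duplicate_nth[OF assms(2,3)])
    also have "(\<Sum>k<n. B $$ (i, k) * v $ k) = (B *\<^sub>v v) $ i"
      using i assms(1,5) by (simp add: scalar_prod_def atLeast0LessThan)
    also have "\<dots> = lam * v $ i"
      using i assms(5,7) by simp
    finally show ?thesis .
  qed
  \<comment> \<open>A single \<open>v $ i\<close> may vanish, so \<open>row_eq\<close> cannot simply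
    be divided by it; the sum of all entries is nonzero by assumption.\<close>
  have "mu * (\<Sum>i<n. v $ i)
    = (\<Sum>i<n. lam * v $ i + (of_nat m - 1) * (B $$ (i, j) * v $ j))"
    by (simp add: sum_distrib_left row_eq)
  also have "\<dots> = lam * (\<Sum>i<n. v $ i) + (of_nat m - 1) * ((\<Sum>i<n. B $$ (i, j)) * v $ j)"
    by (simp only: sum.distrib sum_distrib_left sum_distrib_right)
  finally show ?thesis
    using assms(9) by (simp add: field_simps)
qed

end
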